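(* Let $F$ be a field, let $n\in\{2,3\}$, let $A=(a_{ijk})_{1\le i,j,k\le n}$ be a cubic-matrix of order $n$ over $F$, and let $B$ be a cubic-matrix of order $n$ obtained from $A$ either by interchanging two consecutive vertical pages (the pages $j=m$ and $j=m+1$ for some $m\in\{1,\dots,n-1\}$) or by interchanging two consecutive vertical layers (the layers $k=m$ and $k=m+1$ for some $m\in\{1,\dots,n-1\}$). Then $\det(A)=-\det(B)$, where $\det$ denotes the determinant of cubic-matrices of order 2 and 3 defined in the context.
   Context: A cubic-matrix of order $n$ over a field $F$ is a family $A=(a_{ijk})_{1\le i,j,k\le n}$ with $a_{ijk}\in F$. Fixing the index $j$ gives a "vertical page", fixing $k$ gives a "vertical layer". For a cubic-matrix $A$ of order 2 the determinant is the scalar $$\det(A)=a_{111}a_{222}-a_{112}a_{221}-a_{121}a_{212}+a_{122}a_{211}.$$ For a cubic-matrix $A$ of order 3 the determinant is the scalar $$\begin{aligned}\det(A)={}&a_{111}a_{222}a_{333}-a_{111}a_{232}a_{323}-a_{111}a_{223}a_{332}+a_{111}a_{233}a_{322}\\ &-a_{112}a_{221}a_{333}+a_{112}a_{223}a_{331}+a_{112}a_{231}a_{323}-a_{112}a_{233}a_{321}\\ &+a_{113}a_{221}a_{332}-a_{113}a_{222}a_{331}-a_{113}a_{231}a_{322}+a_{113}a_{232}a_{321}\\ &-a_{121}a_{212}a_{333}+a_{121}a_{213}a_{332}+a_{121}a_{232}a_{313}-a_{121}a_{233}a_{312}\\ &+a_{122}a_{211}a_{333}-a_{122}a_{213}a_{331}-a_{122}a_{231}a_{313}+a_{122}a_{233}a_{311}\\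 &-a_{123}a_{211}a_{332}+a_{123}a_{212}a_{331}+a_{123}a_{231}a_{312}-a_{123}a_{232}a_{311}\\ &+a_{131}a_{212}a_{323}-a_{131}a_{213}a_{322}-a_{131}a_{222}a_{313}+a_{131}a_{223}a_{312}\\ &-a_{132}a_{211}a_{323}+a_{132}a_{213}a_{321}+a_{132}a_{221}a_{313}-a_{132}a_{223}a_{311}\\ &+a_{133}a_{211}a_{322}-a_{133}a_{212}a_{321}-a_{133}a_{221}a_{312}+a_{133}a_{222}a_{311}.\end{aligned}$$ *)

theory Defs
  imports "HOL-Combinatorics.Transposition"
begin

text \<open>
  A cubic-matrix of order \<open>n\<close> is represented by a function of three natural-number indices, of
  which only the values at indices in \<open>{1..n}\<close> are meaningful. Accordingly, the relations below
  constrain entries only at such indices.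
\<close>

type_synonym 'a cubic_matrix = "nat \<Rightarrow> nat \<Rightarrow> nat \<Rightarrow> 'a"

definition cubic_det2 :: "'a::field cubic_matrix \<Rightarrow> 'a" where
  "cubic_det2 a =
      a 1 1 1 * a 2 2 2 - a 1 1 2 * a 2 2 1 - a 1 2 1 * a 2 1 2 + a 1 2 2 * a 2 1 1"

definition cubic_det3 :: "'a::field cubic_matrix \<Rightarrow> 'a" where
  "cubic_det3 a =
      a 1 1 1 * a 2 2 2 * a 3 3 3 - a 1 1 1 * a 2 3 2 * a 3 2 3
    - a 1 1 1 * a 2 2 3 * a 3 3 2 + a 1 1 1 * a 2 3 3 * a 3 2 2
    - a 1 1 2 * a 2 2 1 * a 3 3 3 + a 1 1 2 * a 2 2 3 * a 3 3 1
    + a 1 1 2 * a 2 3 1 * a 3 2 3 - a 1 1 2 * a 2 3 3 * a 3 2 1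
    + a 1 1 3 * a 2 2 1 * a 3 3 2 - a 1 1 3 * a 2 2 2 * a 3 3 1
    - a 1 1 3 * a 2 3 1 * a 3 2 2 + a 1 1 3 * a 2 3 2 * a 3 2 1
    - a 1 2 1 * a 2 1 2 * a 3 3 3 + a 1 2 1 * a 2 1 3 * a 3 3 2
    + a 1 2 1 * a 2 3 2 * a 3 1 3 - a 1 2 1 * a 2 3 3 * a 3 1 2
    + a 1 2 2 * a 2 1 1 * a 3 3 3 - a 1 2 2 * a 2 1 3 * a 3 3 1
    - a 1 2 2 * a 2 3 1 * a 3 1 3 + a 1 2 2 * a 2 3 3 * a 3 1 1
    - a 1 2 3 * a 2 1 1 * a 3 3 2 + a 1 2 3 * a 2 1 2 * a 3 3 1
    + a 1 2 3 * a 2 3 1 * a 3 1 2 - a 1 2 3 * a 2 3 2 * a 3 1 1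
    + a 1 3 1 * a 2 1 2 * a 3 2 3 - a 1 3 1 * a 2 1 3 * a 3 2 2
    - a 1 3 1 * a 2 2 2 * a 3 1 3 + a 1 3 1 * a 2 2 3 * a 3 1 2
    - a 1 3 2 * a 2 1 1 * a 3 2 3 + a 1 3 2 * a 2 1 3 * a 3 2 1
    + a 1 3 2 * a 2 2 1 * a 3 1 3 - a 1 3 2 * a 2 2 3 * a 3 1 1
    + a 1 3 3 * a 2 1 1 * a 3 2 2 - a 1 3 3 * a 2 1 2 * a 3 2 1
    - a 1 3 3 * a 2 2 1 * a 3 1 2 + a 1 3 3 * a 2 2 2 * a 3 1 1"

text \<open>The determinant is only defined for orders 2 and 3.\<close>

definition cubic_det :: "nat \<Rightarrow> 'a::field cubic_matrix \<Rightarrow> 'a" where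
  "cubic_det n a = (if n = 2 then cubic_det2 a else if n = 3 then cubic_det3 a else undefined)"

definition pages_interchanged ::
    "nat \<Rightarrow> nat \<Rightarrow> nat \<Rightarrow> 'a cubic_matrix \<Rightarrow> 'a cubic_matrix \<Rightarrow> bool" where
  "pages_interchanged n p q a b \<longleftrightarrow>
     (\<forall>i\<in>{1..n}. \<forall>j\<in>{1..n}. \<forall>k\<in>{1..n}. b i j k = a i (transpose p q j) k)"

definition layers_interchanged ::
    "nat \<Rightarrow> nat \<Rightarrow> nat \<Rightarrow> 'a cubic_matrix \<Rightarrow> 'a cubic_matrix \<Rightarrow> bool" where
  "layers_interchanged n p q a b \<longleftrightarrow>
     (\<forall>i\<in>{1..n}. \<forall>j\<in>{1..n}. \<forall>k\<in>{1..n}. b i j k = a i j (transpose p q k))"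

end

theory Submission
  imports Defs
begin

text \<open>For both orders the determinant is the sum over pairs of permutations (s, t) of sgn(s)
  sgn(t) times the product over i of the entries at (i, s(i), t(i)). Swapping two pages composes s
  with a transposition, swapping two layers does so with t, so every sign flips. With so few terms,
  \<open>cubic_det_transpose_pages\<close> and \<open>cubic_det_transpose_layers\<close> check this
  by expansion.\<close>

text \<open>Matrices are total functions but only entries in range are meaningful; this lets
  \<open>B\<close> be replaced by a transposed \<open>A\<close> although they may differ out of
  range.\<close>

lemma cubic_det_cong:
  assumes "n \<in> {2, 3}"
    and "\<And>i j k. i \<in> {1..n} \<Longrightarrow> j \<in> {1..n} \<Longrightarrow> k \<in> {1..n} \<Longrightarrow> a i j k = b i j k"
  shows "cubic_det n a = cubic_det n b"
  using assms by (auto simp: cubic_det_def cubic_det2_def cubic_det3_def)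

lemma cubic_det_transpose_pages:
  assumes "n \<in> {2, 3}" and "m \<in> {1..n-1}"
  shows "cubic_det n (\<lambda>i j k. a i (transpose m (m + 1) j) k) = - cubic_det n a"
proof -
  consider "n = 2" "m = 1" | "n = 3" "m = 1" | "n = 3" "m = 2"
    using assms by fastforce
  then show ?thesis
    \<comment> \<open>In each case a polynomial identity remains. The flipped rule folds
      \<open>Suc (Suc 0)\<close> back to \<open>2\<close>, the form of the indices in the
      determinant formulas.\<close>
    by cases (simp_all add: cubic_det_def cubic_det2_def cubic_det3_def transpose_def algebra_simps
          flip: numeral_2_eq_2)
qed

lemma cubic_det_transpose_layers:
  assumes "n \<in> {2, 3}" and "m \<in> {1..n-1}"
  shows "cubic_det n (\<lambda>i j k. a i j (transpose m (m + 1) k)) = - cubic_det n a"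
proof -
  consider "n = 2" "m = 1" | "n = 3" "m = 1" | "n = 3" "m = 2"
    using assms by fastforce
  then show ?thesis
    by cases (simp_all add: cubic_det_def cubic_det2_def cubic_det3_def transpose_def algebra_simps
          flip: numeral_2_eq_2)
qed

theorem theorem3:
  fixes A B :: "'a::field cubic_matrix" and n :: nat
  assumes "n \<in> {2, 3}"
    and "\<exists>m\<in>{1..n-1}. pages_interchanged n m (m + 1) A B \<or> layers_interchanged n m (m + 1) A B"
  shows "cubic_det n A = - cubic_det n B"
proof -
  obtain m where m: "m \<in> {1..n-1}"
    and "pages_interchanged n m (m + 1) A B \<or> layers_interchanged n m (m + 1) A B"
    using assms(2) by blast
  then consider "pages_interchanged n m (m + 1) A B" | "layers_interchanged n m (m + 1) A B"
    by blast
  then show ?thesis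
  proof cases
    case 1
    then have "cubic_det n B = cubic_det n (\<lambda>i j k. A i (transpose m (m + 1) j) k)"
      by (intro cubic_det_cong[OF assms(1)]) (simp add: pages_interchanged_def)
    then show ?thesis
      \<comment> \<open>The lemma gives \<open>cubic_det n B\<close> as the negative of
        \<open>cubic_det n A\<close>, hence the double negation.\<close>
      by (simp only: cubic_det_transpose_pages[OF assms(1) m] minus_minus)
  next
    case 2
    then have "cubic_det n B = cubic_det n (\<lambda>i j k. A i j (transpose m (m + 1) k))"
      by (intro cubic_det_cong[OF assms(1)]) (simp add: layers_interchanged_def)
    then show ?thesis
      by (simp only: cubic_det_transpose_layers[OF assms(1) m] minus_minus)
  qed
qed

end
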